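(* Let $b\ge1$, let $G$ be an ordered graph containing no ordered copy of $Q_{2,b}$, and put $T=T_b(G)$ and $R=V(G)\setminus T$. Then: (i) there are no forward edges from $R$ to $T$, i.e. there is no edge $xy\in E(G)$ with $x<y$, $x\in R$, $y\in T$; (ii) $G[T]$ is ordered-triangle-free; (iii) $G[R]$ contains no monotone copy of $\vec P_{b+1}$.
   Context: An ordered graph is a finite graph with a fixed linear order on its vertices. An ordered copy of $F$ in $G$ is an injective, order-preserving map $V(F)\to V(G)$ sending edges to edges (not necessarily induced). For $b\ge1$, $Q_{2,b}$ is the ordered graph on vertices $1<2<\cdots<b+3$ with edges $12,\ 13,\ 23,\ 34,\ 45,\ \ldots,\ (b+2)(b+3)$. $T_b(G)$ is the set of vertices $z$ for which there exist $z=v_0<v_1<\cdots<v_b$ in $V(G)$ with $v_{i-1}v_i\in E(G)$ for $1\le i\le b$. A graph is ordered-triangle-free if it has no $x<y<z$ with $xy,xz,yz$ all edges. A monotone copy of $\vec P_k$ is a sequence $v_1<\cdots<v_k$ with $v_iv_{i+1}$ an edge for $1\le i<k$. *)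

theory Defs
  imports Main
begin

text \<open>
  The linear order on the vertices is the order of the vertex type, restricted to \<open>verts G\<close>;
  the graphs are simple, so an edge is a two-element set of vertices.
\<close>

record 'a graph =
  verts :: "'a set"
  edges :: "'a set set"

definition ordered_graph :: "'a::linorder graph \<Rightarrow> bool" where
  "ordered_graph G \<longleftrightarrow>
     finite (verts G) \<and> (\<forall>e\<in>edges G. e \<subseteq> verts G \<and> card e = 2)"

definition induced :: "'a graph \<Rightarrow> 'a set \<Rightarrow> 'a graph" where
  "induced G S = \<lparr>verts = verts G \<inter> S, edges = {e \<in> edges G. e \<subseteq> S}\<rparr>"

definition ordered_copy :: "'b::linorder graph \<Rightarrow> 'a::linorder graph \<Rightarrow> ('b \<Rightarrow> 'a) \<Rightarrow> bool" where
  "ordered_copy F G f \<longleftrightarrow>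
     f ` verts F \<subseteq> verts G \<and> inj_on f (verts F) \<and> mono_on (verts F) f \<and>
     (\<forall>e\<in>edges F. f ` e \<in> edges G)"

definition contains_ordered :: "'a::linorder graph \<Rightarrow> 'b::linorder graph \<Rightarrow> bool" where
  "contains_ordered G F \<longleftrightarrow> (\<exists>f. ordered_copy F G f)"

text \<open>The graph $Q_{2,b}$: a triangle on 1, 2, 3 with the path 3, 4, ..., b + 3 attached.\<close>

definition Q2 :: "nat \<Rightarrow> nat graph" where
  "Q2 b = \<lparr>verts = {1..b + 3},
           edges = {{1, 2}, {1, 3}, {2, 3}} \<union> {{i, i + 1} | i. 3 \<le> i \<and> i \<le> b + 2}\<rparr>"

definition forward_set :: "nat \<Rightarrow> 'a::linorder graph \<Rightarrow> 'a set" where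
  "forward_set b G =
     {z \<in> verts G. \<exists>v :: nat \<Rightarrow> 'a. v 0 = z \<and> (\<forall>i\<in>{0..b}. v i \<in> verts G) \<and>
        (\<forall>i\<in>{1..b}. v (i - 1) < v i \<and> {v (i - 1), v i} \<in> edges G)}"

definition ordered_triangle_free :: "'a::linorder graph \<Rightarrow> bool" where
  "ordered_triangle_free G \<longleftrightarrow>
     \<not> (\<exists>x\<in>verts G. \<exists>y\<in>verts G. \<exists>z\<in>verts G. x < y \<and> y < z \<and>
          {x, y} \<in> edges G \<and> {x, z} \<in> edges G \<and> {y, z} \<in> edges G)"

text \<open>The index \<open>k\<close> counts vertices: the path has \<open>k\<close> vertices \<open>v 1, ..., v k\<close>.\<close>

definition monotone_path_copy :: "nat \<Rightarrow> 'a::linorder graph \<Rightarrow> (nat \<Rightarrow> 'a) \<Rightarrow> bool" where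
  "monotone_path_copy k G v \<longleftrightarrow>
     (\<forall>i\<in>{1..k}. v i \<in> verts G) \<and>
     (\<forall>i\<in>{1..<k}. v i < v (i + 1) \<and> {v i, v (i + 1)} \<in> edges G)"

lemma ordered_graph_Q2: "ordered_graph (Q2 b)"
  by (auto simp: ordered_graph_def Q2_def)

lemma ordered_graph_induced: "ordered_graph G \<Longrightarrow> ordered_graph (induced G S)"
  by (auto simp: ordered_graph_def induced_def)

end

theory Submission
  imports Defs
begin

text \<open>
  Membership of \<open>z\<close> in \<open>forward_set b G\<close> says that an increasing path with \<open>b\<close> edges starts
  at \<open>z\<close>. All three parts rest on attaching something to, or reading off, such a path.

  For (i), a forward edge \<open>xy\<close> extends the path at \<open>y\<close> to a longer one at \<open>x\<close>, so \<open>x\<close> is in the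
  forward set whenever \<open>y\<close> is (\<open>forward_set_backward_closed\<close>). For (ii), a triangle \<open>x < y < z\<close> glued to the path that
  starts at its top vertex \<open>z\<close> is exactly an ordered copy of \<open>Q2 b\<close>
  (\<open>contains_Q2_if_triangle_below_forward_set\<close>). For (iii), a monotone path
  with \<open>b + 1\<close> vertices has \<open>b\<close> edges, so it witnesses that its first vertex belongs to the
  forward set, not to the complement (\<open>monotone_path_start_in_forward_set\<close>).
\<close>

lemma strict_mono_on_atLeastAtMost_nat_stepI:
  fixes f :: "nat \<Rightarrow> 'a::order"
  assumes step: "\<And>i. m \<le> i \<Longrightarrow> i < n \<Longrightarrow> f i < f (Suc i)"
  shows "strict_mono_on {m..n} f"
proof (rule strict_mono_onI)
  fix i j assume "i \<in> {m..n}" "j \<in> {m..n}" "i < j"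
  then have "m \<le> i" "j \<le> n" by auto
  from \<open>i < j\<close> \<open>j \<le> n\<close> show "f i < f j"
  proof (induction j)
    case (Suc j)
    then have "f j < f (Suc j)"
      using step \<open>m \<le> i\<close> by simp
    then show ?case
      using Suc by (auto simp: less_Suc_eq)
  qed simp
qed

text \<open>
  Putting \<open>x\<close> in front of a path with \<open>b\<close> edges gives one with \<open>b + 1\<close> edges; its last vertex is
  dropped by reading only the indices up to \<open>b\<close>.
\<close>

lemma forward_set_backward_closed:
  assumes y: "y \<in> forward_set b G" and x: "x \<in> verts G"
    and "x < y" and "{x, y} \<in> edges G"
  shows "x \<in> forward_set b G"
proof -
  obtain v where v0: "v 0 = y" and vV: "\<And>i. i \<le> b \<Longrightarrow> v i \<in> verts G"
    and step: "\<And>i. 1 \<le> i \<Longrightarrow> i \<le> b \<Longrightarrow> v (i - 1) < v i \<and> {v (i - 1), v i} \<in> edges G"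
    using y unfolding forward_set_def by auto
  define w where "w = case_nat x v"
  have "w i \<in> verts G" if "i \<le> b" for i
    using that x vV by (auto simp: w_def split: nat.split)
  moreover have "w (i - 1) < w i \<and> {w (i - 1), w i} \<in> edges G" if "1 \<le> i" "i \<le> b" for i
  proof (cases "i = 1")
    case True
    then show ?thesis using assms v0 by (simp add: w_def)
  next
    case False
    then obtain k where "i = Suc (Suc k)"
      using \<open>1 \<le> i\<close> by (cases i; cases "i - 1") auto
    then show ?thesis using step[of "Suc k"] that by (simp add: w_def)
  qed
  moreover have "w 0 = x" by (simp add: w_def)
  ultimately show ?thesis
    using x unfolding forward_set_def by auto
qed

text \<open>
  The tail 3, 4, ..., b + 3 of \<open>Q2 b\<close> has \<open>b\<close> edges, exactly the length of the path that starts
  at \<open>z\<close>. Since \<open>x < y < z\<close> and that path increases from \<open>z\<close>, the combined map is strictly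
  increasing, which gives both injectivity and monotonicity of the copy.
\<close>

lemma contains_Q2_if_triangle_below_forward_set:
  assumes x: "x \<in> verts G" and y: "y \<in> verts G" and z: "z \<in> forward_set b G"
    and less: "x < y" "y < z"
    and edges: "{x, y} \<in> edges G" "{x, z} \<in> edges G" "{y, z} \<in> edges G"
  shows "contains_ordered G (Q2 b)"
proof -
  obtain v where v0: "v 0 = z" and vV: "\<And>i. i \<le> b \<Longrightarrow> v i \<in> verts G"
    and step: "\<And>i. 1 \<le> i \<Longrightarrow> i \<le> b \<Longrightarrow> v (i - 1) < v i \<and> {v (i - 1), v i} \<in> edges G"
    using z unfolding forward_set_def by auto
  \<comment> \<open>The path of \<open>Q2 b\<close> starts at vertex 3, hence the shift.\<close>
  define f where "f i = (if i = 1 then x else if i = 2 then y else v (i - 3))" for i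
  have f_path: "f i < f (Suc i) \<and> {f i, f (Suc i)} \<in> edges G" if "3 \<le> i" "i \<le> b + 2" for i
  proof -
    have "f i = v (i - 2 - 1)" "f (Suc i) = v (i - 2)"
      using that by (auto simp: f_def eval_nat_numeral)
    then show ?thesis using step[of "i - 2"] that by simp
  qed
  have f_simps: "f 1 = x" "f 2 = y" "f 3 = z"
    by (simp_all add: f_def v0)
  have "f i < f (Suc i)" if "1 \<le> i" "i < b + 3" for i
  proof -
    have "i = 1 \<or> i = 2 \<or> 3 \<le> i" using that by linarith
    then consider "i = 1" | "i = 2" | "3 \<le> i" by blast
    then show ?thesis
    proof cases
      case 3
      then show ?thesis using f_path[of i] that by simp
    qed (use less f_simps in \<open>simp_all add: numeral_2_eq_2 numeral_3_eq_3\<close>)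
  qed
  then have mono: "strict_mono_on {1..b + 3} f"
    by (rule strict_mono_on_atLeastAtMost_nat_stepI)
  have "f ` {1..b + 3} \<subseteq> verts G"
    using x y vV by (auto simp: f_def)
  moreover have "f ` e \<in> edges G" if "e \<in> edges (Q2 b)" for e
    using that edges f_path f_simps unfolding Q2_def by auto
  ultimately have "ordered_copy (Q2 b) G f"
    using mono strict_mono_on_imp_inj_on[OF mono] strict_mono_on_imp_mono_on[OF mono]
    by (simp add: ordered_copy_def Q2_def)
  then show ?thesis unfolding contains_ordered_def by blast
qed

lemma monotone_path_start_in_forward_set:
  assumes "monotone_path_copy (b + 1) G v"
  shows "v 1 \<in> forward_set b G"
proof -
  \<comment> \<open>Paths are indexed from 1, witnesses of the forward set from 0.\<close>
  have "v (Suc i) \<in> verts G" if "i \<le> b" for i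
    using assms that by (auto simp: monotone_path_copy_def)
  moreover have "v (Suc (i - 1)) < v (Suc i) \<and> {v (Suc (i - 1)), v (Suc i)} \<in> edges G"
    if "1 \<le> i" "i \<le> b" for i
    using assms that by (auto simp: monotone_path_copy_def)
  ultimately show ?thesis
    unfolding forward_set_def by (auto intro!: exI[of _ "\<lambda>i. v (Suc i)"])
qed

lemma monotone_path_copy_induced:
  assumes "monotone_path_copy k (induced G S) v"
  shows "monotone_path_copy k G v"
  using assms by (auto simp: monotone_path_copy_def induced_def)

theorem lemma5p1:
  fixes b :: nat and G :: "'a::linorder graph" and T R :: "'a set"
  assumes "b \<ge> 1"
    and "ordered_graph G"
    and "\<not> contains_ordered G (Q2 b)"
    and "T = forward_set b G"
    and "R = verts G - T"
  shows "(\<not> (\<exists>x y. {x, y} \<in> edges G \<and> x < y \<and> x \<in> R \<and> y \<in> T)) \<and>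
         ordered_triangle_free (induced G T) \<and>
         (\<not> (\<exists>v. monotone_path_copy (b + 1) (induced G R) v))"
proof (intro conjI notI)
  assume "\<exists>x y. {x, y} \<in> edges G \<and> x < y \<and> x \<in> R \<and> y \<in> T"
  then show False
    using forward_set_backward_closed assms(4,5) by blast
next
  show "ordered_triangle_free (induced G T)"
    unfolding ordered_triangle_free_def induced_def
    using contains_Q2_if_triangle_below_forward_set[of _ G _ _ b] assms(3,4) by auto
next
  assume "\<exists>v. monotone_path_copy (b + 1) (induced G R) v"
  then obtain v where v: "monotone_path_copy (b + 1) (induced G R) v" ..
  then have "v 1 \<in> R"
    by (auto simp: monotone_path_copy_def induced_def)
  moreover have "v 1 \<in> T"
    using monotone_path_start_in_forward_set[OF monotone_path_copy_induced[OF v]] assms(4) by simp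
  ultimately show False
    using assms(5) by simp
qed

end
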